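(* Let $P\subset\mathbb{R}^d$ be a $d$-dimensional hyperrectangle, let $\mathscr{D}^N$ be the polytope division of $P$ at step $N\ge1$ of the Polytope Division Method (described in the context), and let $D\in\mathscr{D}^N$. Then the number of facets of $D$ satisfies $|\partial D|\le 2d$, where $|\cdot|$ denotes the cardinality of a set.
   Context: **Polytopes and faces.** $\mathrm{Conv}(M)$ denotes the convex hull of $M\subset\mathbb{R}^d$. A polytope is the convex hull of a non-empty finite set of points in $\mathbb{R}^d$; its dimension is the dimension of its affine hull. A face of a polytope $Q$ is a convex subset $F\subset Q$ for which there exist $c\in\mathbb{R}^d$, $c_0\in\mathbb{R}$ with $F=Q\cap\{x: c\cdot x=c_0\}$ and $c\cdot x\le c_0$ for all $x\in Q$. A facet of $Q$ is a face $F$ with $0\le\dim F=\dim Q-1$; a vertex is a face of dimension $0$. $\partial Q$ denotes the (finite) set of facets of $Q$. **Hyperrectangle.** A $d$-dimensional hyperrectangle is a set $[l_1,u_1]\times\cdots\times[l_d,u_d]$ with $l_i<u_i$. **Barycenter and facet linking.** If a polytope $D$ has vertices $v_1,\dots,v_m$, its barycenter is $\mathsf{b}_D=\frac1m\sum_{i=1}^m v_i$. For a polytope $D$ and a point $q\in D$, the facet linking operator is $\mathsf{FL}(q,D)=\{\mathrm{Conv}(\{q\}\cup F): F\in\partial D\}$. **Objective function.** $J(p,\gamma)\in\mathbb{R}$ is defined for $p\in P$ and finite non-empty $\gamma\subset P$, and satisfies: $J(p,\gamma)\ge0$; $J(\cdot,\gamma)$ is Lipschitz continuous with constant $L_J$;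 $J(p,\gamma)=0$ for $p\in\gamma$; and $J(p,\gamma')\le J(p,\gamma)$ whenever $\gamma\subset\gamma'$. **Polytope Division Method (PDM).** Given the hyperrectangle $P$, the objective $J$ and a tolerance $\mathrm{tol}$: choose $p\in\mathrm{int}(P)$, set $\gamma^1=\{p\}$, $\mathscr{D}^1=\mathsf{FL}(p,P)$ and $\mathrm{err}=\mathrm{tol}+1$. While $\mathrm{err}>\mathrm{tol}$, given $\gamma^{N}$ and $\mathscr{D}^{N}$, choose some $D\in\arg\max_{E\in\mathscr{D}^{N}}J(\mathsf{b}_E,\gamma^{N})$, set $\mathrm{err}=J(\mathsf{b}_D,\gamma^{N})$, $\gamma^{N+1}=\gamma^{N}\cup\{\mathsf{b}_D\}$ and $\mathscr{D}^{N+1}=(\mathscr{D}^{N}\setminus\{D\})\cup\mathsf{FL}(\mathsf{b}_D,D)$. The family $\mathscr{D}^N$ is the polytope division of $P$ at step $N$ (for every $N\ge1$ reached by the algorithm). *)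

theory Defs
  imports "HOL-Analysis.Analysis"
begin

text \<open>
  Faces are cut out by supporting hyperplanes, i.e. they are the exposed faces of the library.
  For polytopes the notions below agree with \<^const>\<open>facet_of\<close> and \<^const>\<open>extreme_point_of\<close>,
  which are based on extreme faces; see \<open>facets_polytope\<close> and \<open>vertices_polytope\<close>.
\<close>

definition facets :: "'a::euclidean_space set \<Rightarrow> 'a set set" where
  "facets Q = {F. F exposed_face_of Q \<and> 0 \<le> aff_dim F \<and> aff_dim F = aff_dim Q - 1}"

definition vertices :: "'a::euclidean_space set \<Rightarrow> 'a set" where
  "vertices Q = {v. {v} exposed_face_of Q}"

lemma facets_polytope:
  assumes "polytope Q"
  shows "facets Q = {F. F facet_of Q}"
proof -
  have "0 \<le> aff_dim F \<longleftrightarrow> F \<noteq> {}" for F :: "'a set"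
    by (metis aff_dim_empty aff_dim_negative_iff not_le)
  then show ?thesis
    using exposed_face_of_polyhedron[OF polytope_imp_polyhedron[OF assms]]
    by (auto simp: facets_def facet_of_def)
qed

lemma vertices_polytope:
  assumes "polytope Q"
  shows "vertices Q = {v. v extreme_point_of Q}"
  using exposed_face_of_polyhedron[OF polytope_imp_polyhedron[OF assms]]
  by (auto simp: vertices_def face_of_singleton)

definition barycenter :: "'a::euclidean_space set \<Rightarrow> 'a" where
  "barycenter D = (1 / real (card (vertices D))) *\<^sub>R (\<Sum>v\<in>vertices D. v)"

definition facet_linking :: "'a::euclidean_space \<Rightarrow> 'a set \<Rightarrow> 'a set set" where
  "facet_linking q D = {convex hull ({q} \<union> F) | F. F \<in> facets D}"

definition hyperrectangle :: "(real ^ 'n) set \<Rightarrow> bool" where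
  "hyperrectangle P \<longleftrightarrow> (\<exists>l u. (\<forall>i. l $ i < u $ i) \<and> P = {x. \<forall>i. l $ i \<le> x $ i \<and> x $ i \<le> u $ i})"

lemma hyperrectangle_cbox:
  "hyperrectangle P \<longleftrightarrow> (\<exists>l u. (\<forall>i. l $ i < u $ i) \<and> P = cbox l u)"
  by (auto simp: hyperrectangle_def cbox_def Basis_vec_def inner_axis)

text \<open>The Lipschitz constant \<open>L\<close> is uniform in \<open>\<gamma>\<close>. Values of \<open>J\<close> for \<open>p \<notin> P\<close>, or for \<open>\<gamma>\<close>
  empty, infinite or not contained in \<open>P\<close>, are irrelevant.\<close>

definition objective :: "'a::euclidean_space set \<Rightarrow> real \<Rightarrow> ('a \<Rightarrow> 'a set \<Rightarrow> real) \<Rightarrow> bool" where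
  "objective P L J \<longleftrightarrow>
     (\<forall>\<gamma>. finite \<gamma> \<and> \<gamma> \<noteq> {} \<and> \<gamma> \<subseteq> P \<longrightarrow>
        (\<forall>p\<in>P. 0 \<le> J p \<gamma>) \<and>
        L-lipschitz_on P (\<lambda>p. J p \<gamma>) \<and>
        (\<forall>p\<in>\<gamma>. J p \<gamma> = 0)) \<and>
     (\<forall>\<gamma> \<gamma>'. finite \<gamma>' \<and> \<gamma> \<noteq> {} \<and> \<gamma> \<subseteq> \<gamma>' \<and> \<gamma>' \<subseteq> P \<longrightarrow> (\<forall>p\<in>P. J p \<gamma>' \<le> J p \<gamma>))"

text \<open>\<open>pdm P J tol N \<gamma> \<D> err\<close>: some run of the algorithm (for some choice of the starting point
  and of the maximisers) reaches step \<open>N\<close> with \<open>\<gamma>\<^sup>N = \<gamma>\<close>, \<open>\<D>\<^sup>N = \<D>\<close> and current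
  value \<open>err\<close> of the error variable.\<close>

inductive pdm ::
  "'a::euclidean_space set \<Rightarrow> ('a \<Rightarrow> 'a set \<Rightarrow> real) \<Rightarrow> real \<Rightarrow>
   nat \<Rightarrow> 'a set \<Rightarrow> 'a set set \<Rightarrow> real \<Rightarrow> bool"
  for P J tol where
  init: "p \<in> interior P \<Longrightarrow> pdm P J tol 1 {p} (facet_linking p P) (tol + 1)"
| step: "pdm P J tol N \<gamma> \<D> err \<Longrightarrow> err > tol \<Longrightarrow>
         is_arg_max (\<lambda>E. J (barycenter E) \<gamma>) (\<lambda>E. E \<in> \<D>) D \<Longrightarrow>
         pdm P J tol (N + 1) (\<gamma> \<union> {barycenter D})
           ((\<D> - {D}) \<union> facet_linking (barycenter D) D) (J (barycenter D) \<gamma>)"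

text \<open>\<open>\<D>\<close> is a polytope division of \<open>P\<close> at step \<open>N\<close>.\<close>

definition polytope_division ::
  "'a::euclidean_space set \<Rightarrow> ('a \<Rightarrow> 'a set \<Rightarrow> real) \<Rightarrow> real \<Rightarrow> nat \<Rightarrow> 'a set set \<Rightarrow> bool" where
  "polytope_division P J tol N \<D> \<longleftrightarrow> (\<exists>\<gamma> err. pdm P J tol N \<gamma> \<D> err)"

end

theory Submission
  imports Defs
begin

text \<open>
  Every polytope of a division is an iterated pyramid over a face of the box \<open>P\<close>, and each passage
  to a pyramid raises the dimension by one. If the base has positive dimension, then the number of
  facets also grows by just one: the facets of a pyramid are its base and the pyramids over the
  facets of the base. A \<open>k\<close>-dimensional box has \<open>2 * k\<close> facets, so the bound
  ``at most \<open>2 * dim\<close> facets'' survives. A point has no facets and the segment over it has two,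
  which fits the bound as well.

  The method forms a pyramid over a facet \<open>F\<close> of \<open>D\<close>, not over \<open>D\<close> itself, so an induction
  along its run needs the bound for \<open>F\<close>. It is therefore required of all faces of a polytope
  at once (\<open>box_like\<close>). This hereditary bound holds for boxes, because their faces are boxes again
  (\<open>box_like_cbox\<close>); it passes to faces trivially, and from a base to a pyramid because the faces
  of a pyramid are the faces of the base and the pyramids over them
  (\<open>box_like_pyramid\<close>). Finally, the linking point is always in the relative interior of the
  polytope that is divided (\<open>barycenter_in_rel_interior\<close>), hence off the affine hull of each facet,
  so that the new pieces are true pyramids.
\<close>

section \<open>A facet bound inherited by faces and pyramids\<close>

text \<open>
  Contrary to \<open>facets\<close>, the empty face of a point is admitted here. With it, the faces of
  codimension one of a pyramid are the base and the pyramids over those of the base also when the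
  base is a point: the apex is the pyramid over the empty face.
\<close>

definition codim1_faces :: "'a::euclidean_space set \<Rightarrow> 'a set set" where
  "codim1_faces Q = {F. F face_of Q \<and> aff_dim F = aff_dim Q - 1}"

text \<open>The maximum with 1 accounts for the empty face of a point.\<close>

definition box_like :: "'a::euclidean_space set \<Rightarrow> bool" where
  "box_like Q \<longleftrightarrow> polytope Q \<and>
     (\<forall>G. G face_of Q \<longrightarrow> card (codim1_faces G) \<le> max 1 (2 * nat (aff_dim G)))"

lemma finite_codim1_faces: "polytope Q \<Longrightarrow> finite (codim1_faces Q)"
  by (rule finite_subset[OF _ finite_polytope_faces]) (auto simp: codim1_faces_def)

lemma facets_subset_codim1_faces: "facets Q \<subseteq> codim1_faces Q"
  by (auto simp: facets_def codim1_faces_def exposed_face_of_def)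

lemma box_like_face:
  assumes "box_like Q" "F face_of Q"
  shows "box_like F"
  using assms face_of_polytope_polytope face_of_trans unfolding box_like_def by metis

lemma face_of_pyramid_cases:
  assumes "polytope B" "q \<notin> affine hull B" "F face_of (convex hull (insert q B))"
  obtains "F face_of B"
  | F' where "F' face_of B" "F = convex hull (insert q F')" "aff_dim F = aff_dim F' + 1"
proof -
  obtain S where S: "finite S" "B = convex hull S"
    using assms(1) by (auto simp: polytope_def)
  have q: "q \<notin> affine hull S"
    using assms(2) S by simp
  have "convex hull (insert q B) = convex hull (insert q S)"
    unfolding S by (rule hull_insert[symmetric])
  then have "F face_of B \<or> (\<exists>F'. F' face_of B \<and> F = convex hull (insert q F'))"
    using assms(3) face_of_convex_hull_insert_eq[OF S(1) q] S(2) by simp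
  moreover have "aff_dim (convex hull (insert q F')) = aff_dim F' + 1" if "F' face_of B" for F'
  proof -
    have "q \<notin> affine hull F'"
      using assms(2) hull_mono[OF face_of_imp_subset[OF that], of affine] by blast
    then show ?thesis
      by (simp add: aff_dim_convex_hull aff_dim_insert)
  qed
  ultimately show thesis
    using that by blast
qed

lemma card_codim1_faces_pyramid:
  assumes "polytope B" "q \<notin> affine hull B"
  shows "card (codim1_faces (convex hull (insert q B))) \<le> 1 + card (codim1_faces B)"
proof -
  let ?Q = "convex hull (insert q B)"
  have dim: "aff_dim ?Q = aff_dim B + 1"
    using assms(2) by (simp add: aff_dim_convex_hull aff_dim_insert)
  have "codim1_faces ?Q \<subseteq> insert B ((\<lambda>F. convex hull (insert q F)) ` codim1_faces B)"
  proof
    fix F assume F: "F \<in> codim1_faces ?Q"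
    then have "F face_of ?Q" "aff_dim F = aff_dim B"
      by (auto simp: codim1_faces_def dim)
    from assms this(1) show "F \<in> insert B ((\<lambda>F. convex hull (insert q F)) ` codim1_faces B)"
    proof (cases rule: face_of_pyramid_cases)
      case 1
      then have "F = B"
        using face_of_aff_dim_lt[OF polytope_imp_convex[OF assms(1)] 1] \<open>aff_dim F = aff_dim B\<close>
        by auto
      then show ?thesis by simp
    next
      case (2 F')
      then show ?thesis
        using \<open>aff_dim F = aff_dim B\<close> by (auto simp: codim1_faces_def)
    qed
  qed
  moreover have fin: "finite (codim1_faces B)"
    using assms(1) by (rule finite_codim1_faces)
  ultimately have "card (codim1_faces ?Q)
      \<le> card (insert B ((\<lambda>F. convex hull (insert q F)) ` codim1_faces B))"
    by (intro card_mono) auto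
  also have "\<dots> \<le> Suc (card ((\<lambda>F. convex hull (insert q F)) ` codim1_faces B))"
    using fin by (simp add: card_insert_if)
  also have "\<dots> \<le> 1 + card (codim1_faces B)"
    using card_image_le[OF fin] by simp
  finally show ?thesis .
qed

text \<open>
  On passing from a nonempty face \<open>F\<close> of the base to the pyramid over \<open>F\<close>, the bound
  \<open>max 1 (2 * dim F)\<close> grows by at least 1, which pays for the one additional face \<open>F\<close>.
\<close>

lemma box_like_pyramid:
  assumes "box_like B" "q \<notin> affine hull B"
  shows "box_like (convex hull (insert q B))"
  unfolding box_like_def
proof (intro conjI allI impI)
  have B: "polytope B"
    using assms(1) by (simp add: box_like_def)
  then obtain S where "finite S" "B = convex hull S"
    by (auto simp: polytope_def)
  then show "polytope (convex hull (insert q B))"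
    by (metis hull_insert finite_insert polytope_def)
  fix G assume "G face_of (convex hull (insert q B))"
  with B assms(2) show "card (codim1_faces G) \<le> max 1 (2 * nat (aff_dim G))"
  proof (cases rule: face_of_pyramid_cases)
    case 1
    then show ?thesis
      using assms(1) by (simp add: box_like_def)
  next
    case (2 F)
    have "polytope F"
      using B 2(1) by (rule face_of_polytope_polytope)
    moreover have "q \<notin> affine hull F"
      using assms(2) hull_mono[OF face_of_imp_subset[OF 2(1)], of affine] by blast
    ultimately have "card (codim1_faces G) \<le> 1 + card (codim1_faces F)"
      unfolding 2(2) by (rule card_codim1_faces_pyramid)
    also have "\<dots> \<le> 1 + max 1 (2 * nat (aff_dim F))"
      using assms(1) 2(1) by (auto simp: box_like_def)
    finally have *: "card (codim1_faces G) \<le> 1 + max 1 (2 * nat (aff_dim F))" .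
    show ?thesis
    proof (cases "F = {}")
      case True
      \<comment> \<open>Then \<open>G\<close> is the apex, and the estimate just obtained exceeds its bound by 1.\<close>
      then have "codim1_faces F = {}"
        using aff_dim_geq by (auto simp: codim1_faces_def)
      then show ?thesis
        using \<open>card (codim1_faces G) \<le> 1 + card (codim1_faces F)\<close> by simp
    next
      case False
      then have "0 \<le> aff_dim F"
        by (metis aff_dim_negative_iff not_le)
      then show ?thesis
        using * 2(3) by (auto simp: nat_add_distrib)
    qed
  qed
qed

section \<open>Boxes\<close>

lemma cbox_Int_lower_hyperplane:
  assumes "i \<in> Basis" "l \<bullet> i \<le> u \<bullet> i"
  shows "cbox l u \<inter> {x. i \<bullet> x = l \<bullet> i} = cbox l (u + ((l - u) \<bullet> i) *\<^sub>R i)"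
  using assms
  by (fastforce simp: mem_box inner_Basis inner_simps inner_commute split: if_splits)

lemma cbox_Int_upper_hyperplane:
  assumes "i \<in> Basis" "l \<bullet> i \<le> u \<bullet> i"
  shows "cbox l u \<inter> {x. i \<bullet> x = u \<bullet> i} = cbox (l + ((u - l) \<bullet> i) *\<^sub>R i) u"
  using assms
  by (fastforce simp: mem_box inner_Basis inner_simps inner_commute split: if_splits)

lemma lower_face_of_cbox: "i \<in> Basis \<Longrightarrow> (cbox l u \<inter> {x. i \<bullet> x = l \<bullet> i}) face_of cbox l u"
  by (rule face_of_Int_supporting_hyperplane_ge) (auto simp: mem_box inner_commute)

lemma upper_face_of_cbox: "i \<in> Basis \<Longrightarrow> (cbox l u \<inter> {x. i \<bullet> x = u \<bullet> i}) face_of cbox l u"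
  by (rule face_of_Int_supporting_hyperplane_le) (auto simp: mem_box inner_commute)

definition nondegenerate_axes :: "'a::euclidean_space \<Rightarrow> 'a \<Rightarrow> 'a set" where
  "nondegenerate_axes l u = {i \<in> Basis. l \<bullet> i < u \<bullet> i}"

lemma finite_nondegenerate_axes [simp]: "finite (nondegenerate_axes l u)"
  by (simp add: nondegenerate_axes_def)

lemma nondegenerate_axes_collapse:
  assumes "i \<in> Basis"
  shows "nondegenerate_axes l (u + ((l - u) \<bullet> i) *\<^sub>R i) = nondegenerate_axes l u - {i}"
    and "nondegenerate_axes (l + ((u - l) \<bullet> i) *\<^sub>R i) u = nondegenerate_axes l u - {i}"
  using assms by (auto simp: nondegenerate_axes_def inner_simps inner_Basis split: if_splits)

text \<open>Collapsing the nondegenerate axes one by one gives a strictly descending chain of faces.\<close>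

lemma aff_dim_cbox_ge:
  assumes "cbox l u \<noteq> {}"
  shows "int (card (nondegenerate_axes l u)) \<le> aff_dim (cbox l u)"
  using assms
proof (induction "card (nondegenerate_axes l u)" arbitrary: u)
  case 0
  then show ?case
    by (metis aff_dim_negative_iff not_le of_nat_0)
next
  case (Suc n)
  then obtain i where i: "i \<in> nondegenerate_axes l u"
    by (metis card.empty ex_in_conv nat.distinct(1))
  then have iB: "i \<in> Basis" and lt: "l \<bullet> i < u \<bullet> i"
    by (auto simp: nondegenerate_axes_def)
  let ?u = "u + ((l - u) \<bullet> i) *\<^sub>R i"
  have eq: "cbox l ?u = cbox l u \<inter> {x. i \<bullet> x = l \<bullet> i}"
    using cbox_Int_lower_hyperplane[OF iB] lt by simp
  have "l \<in> cbox l ?u" "u \<in> cbox l u" "u \<notin> cbox l ?u"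
    using Suc.prems lt unfolding eq by (auto simp: mem_box box_ne_empty inner_commute)
  then have "cbox l ?u \<noteq> {}" "cbox l ?u \<noteq> cbox l u"
    by auto
  have "n = card (nondegenerate_axes l ?u)"
    using Suc.hyps(2) i by (simp add: nondegenerate_axes_collapse[OF iB])
  then have "int n \<le> aff_dim (cbox l ?u)"
    using Suc.hyps(1) \<open>cbox l ?u \<noteq> {}\<close> by blast
  also have "\<dots> < aff_dim (cbox l u)"
    using \<open>cbox l ?u \<noteq> cbox l u\<close> lower_face_of_cbox[OF iB, of l u]
    unfolding eq by (intro face_of_aff_dim_lt) auto
  finally show ?case
    using Suc.hyps(2) by linarith
qed

text \<open>
  A nonempty proper face is where some linear functional \<open>a\<close> is maximal on the box. If a nondegenerate
  coordinate occurs in \<open>a\<close>, then maximality forces it to an end of its range. Otherwise \<open>a\<close> is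
  constant on the box, which makes the face improper.
\<close>

lemma proper_face_of_cbox:
  assumes F: "F face_of cbox l u" "F \<noteq> {}" "F \<noteq> cbox l u"
  obtains i where "i \<in> nondegenerate_axes l u"
    "F \<subseteq> cbox l u \<inter> {x. i \<bullet> x = l \<bullet> i} \<or> F \<subseteq> cbox l u \<inter> {x. i \<bullet> x = u \<bullet> i}"
proof -
  have "F exposed_face_of cbox l u"
    using F(1) by (simp add: exposed_face_of_polyhedron polytope_imp_polyhedron polytope_interval)
  then obtain a b where ab: "cbox l u \<subseteq> {x. a \<bullet> x \<le> b}" "F = cbox l u \<inter> {x. a \<bullet> x = b}"
    by (auto simp: exposed_face_of_def)
  have ends: "x \<bullet> i = (if a \<bullet> i > 0 then u \<bullet> i else l \<bullet> i)"
    if x: "x \<in> F" and i: "i \<in> Basis" "a \<bullet> i \<noteq> 0" for x i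
  proof (rule ccontr)
    define e where "e = (if a \<bullet> i > 0 then u \<bullet> i else l \<bullet> i)"
    assume "x \<bullet> i \<noteq> (if a \<bullet> i > 0 then u \<bullet> i else l \<bullet> i)"
    then have ne: "x \<bullet> i \<noteq> e" by (simp add: e_def)
    have box: "l \<bullet> j \<le> x \<bullet> j" "x \<bullet> j \<le> u \<bullet> j" if "j \<in> Basis" for j
      using x ab(2) that by (auto simp: mem_box)
    \<comment> \<open>Moving the \<open>i\<close>-th coordinate of \<open>x\<close> to the end that \<open>a\<close> favours would increase \<open>a\<close>.\<close>
    define y where "y = x + (e - x \<bullet> i) *\<^sub>R i"
    have "y \<bullet> j = (if j = i then e else x \<bullet> j)" if "j \<in> Basis" for j
      using that i by (auto simp: y_def inner_simps inner_Basis)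
    then have "y \<in> cbox l u"
      using box box[OF i(1)] by (auto simp: mem_box e_def)
    then have "a \<bullet> y \<le> b" using ab(1) by auto
    moreover have "a \<bullet> y = b + (e - x \<bullet> i) * (a \<bullet> i)"
      using x ab(2) by (simp add: y_def inner_simps)
    moreover have "(e - x \<bullet> i) * (a \<bullet> i) > 0"
      using ne i box[OF i(1)]
      by (cases "a \<bullet> i > 0") (auto simp: e_def zero_less_mult_iff)
    ultimately show False by simp
  qed
  have "\<exists>i\<in>nondegenerate_axes l u. a \<bullet> i \<noteq> 0"
  proof (rule ccontr)
    assume no: "\<not> ?thesis"
    obtain x where x: "x \<in> F" using F(2) by auto
    have "y \<in> F" if y: "y \<in> cbox l u" for y
    proof -
      have "(a \<bullet> i) * (y \<bullet> i) = (a \<bullet> i) * (x \<bullet> i)" if "i \<in> Basis" for i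
      proof (cases "a \<bullet> i = 0")
        case False
        then have "l \<bullet> i \<ge> u \<bullet> i"
          using no that by (fastforce simp: nondegenerate_axes_def not_less)
        moreover have "l \<bullet> i \<le> x \<bullet> i" "x \<bullet> i \<le> u \<bullet> i" "l \<bullet> i \<le> y \<bullet> i" "y \<bullet> i \<le> u \<bullet> i"
          using x y ab(2) that by (auto simp: mem_box)
        ultimately show ?thesis by simp
      qed simp
      then have "a \<bullet> y = a \<bullet> x"
        unfolding euclidean_inner[of a y] euclidean_inner[of a x] by (rule sum.cong[OF refl])
      then show ?thesis
        using x y ab(2) by auto
    qed
    then show False using F(3) ab(2) by blast
  qed
  then obtain i where i: "i \<in> nondegenerate_axes l u" "a \<bullet> i \<noteq> 0" by blast
  then have "i \<in> Basis" by (simp add: nondegenerate_axes_def)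
  then have "F \<subseteq> cbox l u \<inter> {x. i \<bullet> x = l \<bullet> i} \<or> F \<subseteq> cbox l u \<inter> {x. i \<bullet> x = u \<bullet> i}"
    using ends[of _ i] i(2) ab(2) by (cases "a \<bullet> i > 0") (auto simp: inner_commute)
  with i(1) show thesis using that by blast
qed

lemma card_codim1_faces_cbox:
  "card (codim1_faces (cbox l u)) \<le> max 1 (2 * nat (aff_dim (cbox l u)))"
proof -
  define lo hi where "lo = (\<lambda>i. cbox l u \<inter> {x. i \<bullet> x = l \<bullet> i})"
    and "hi = (\<lambda>i. cbox l u \<inter> {x. i \<bullet> x = u \<bullet> i})"
  let ?N = "nondegenerate_axes l u"
  have *: "F = {} \<or> F \<in> lo ` ?N \<union> hi ` ?N" if "F \<in> codim1_faces (cbox l u)" for F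
  proof (cases "F = {}")
    case False
    have F: "F face_of cbox l u" "aff_dim F = aff_dim (cbox l u) - 1"
      using that by (auto simp: codim1_faces_def)
    then have "F \<noteq> cbox l u" by auto
    from F(1) False this obtain i where i: "i \<in> ?N" "F \<subseteq> lo i \<or> F \<subseteq> hi i"
      unfolding lo_def hi_def by (rule proper_face_of_cbox)
    then have iB: "i \<in> Basis" and lt: "l \<bullet> i < u \<bullet> i"
      by (auto simp: nondegenerate_axes_def)
    have "cbox l u \<noteq> {}"
      using False face_of_imp_subset[OF F(1)] by auto
    then have mem: "l \<in> cbox l u" "u \<in> cbox l u"
      by (auto simp: mem_box box_ne_empty)
    \<comment> \<open>\<open>F\<close> has codimension one, so there is no room between it and a proper face around it.\<close>
    have eq: "F = G" if G: "G face_of cbox l u" "G \<noteq> cbox l u" "F \<subseteq> G" for G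
    proof (rule ccontr)
      assume "F \<noteq> G"
      have "F face_of G"
        using F(1) G by (meson face_of_face)
      then have "aff_dim F < aff_dim G"
        using \<open>F \<noteq> G\<close> face_of_imp_convex[OF G(1)] by (intro face_of_aff_dim_lt) auto
      moreover have "aff_dim G < aff_dim (cbox l u)"
        using G by (intro face_of_aff_dim_lt) auto
      ultimately show False using F(2) by simp
    qed
    have "u \<notin> lo i" "l \<notin> hi i"
      using lt by (auto simp: lo_def hi_def inner_commute)
    then have "lo i \<noteq> cbox l u" "hi i \<noteq> cbox l u"
      using mem by auto
    then have "F = lo i \<or> F = hi i"
      using i(2) eq lower_face_of_cbox[OF iB] upper_face_of_cbox[OF iB]
      unfolding lo_def hi_def by blast
    then show ?thesis using i(1) by auto
  qed simp
  show ?thesis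
  proof (cases "1 \<le> aff_dim (cbox l u)")
    case True
    then have "{} \<notin> codim1_faces (cbox l u)"
      by (auto simp: codim1_faces_def)
    then have "codim1_faces (cbox l u) \<subseteq> lo ` ?N \<union> hi ` ?N"
      using * by blast
    then have "card (codim1_faces (cbox l u)) \<le> card (lo ` ?N \<union> hi ` ?N)"
      by (intro card_mono) auto
    also have "\<dots> \<le> card (lo ` ?N) + card (hi ` ?N)"
      by (rule card_Un_le)
    also have "\<dots> \<le> 2 * card ?N"
      using card_image_le[of ?N lo] card_image_le[of ?N hi] by simp
    also have "\<dots> \<le> 2 * nat (aff_dim (cbox l u))"
      using aff_dim_cbox_ge[of l u] True by force
    finally show ?thesis by simp
  next
    case False
    then have "aff_dim F < 0" if "F \<in> codim1_faces (cbox l u)" for F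
      using that by (simp add: codim1_faces_def)
    then have "codim1_faces (cbox l u) \<subseteq> {{}}"
      by (auto simp: aff_dim_negative_iff)
    then have "card (codim1_faces (cbox l u)) \<le> card {{} :: 'a set}"
      by (intro card_mono) auto
    then show ?thesis by simp
  qed
qed

text \<open>
  A nonempty proper face lies in a box with fewer nondegenerate axes and is a face of that box,
  which allows induction on the number of these axes.
\<close>

lemma box_like_cbox: "box_like (cbox l u)"
proof (induction "card (nondegenerate_axes l u)" arbitrary: l u rule: less_induct)
  case less
  show ?case
    unfolding box_like_def
  proof (intro conjI allI impI)
    show "polytope (cbox l u)" by (rule polytope_interval)
    fix G assume G: "G face_of cbox l u"
    consider "G = {}" | "G = cbox l u" | "G \<noteq> {}" "G \<noteq> cbox l u" by blast
    then show "card (codim1_faces G) \<le> max 1 (2 * nat (aff_dim G))"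
    proof cases
      case 1
      then have "codim1_faces G \<subseteq> {{}}"
        by (auto simp: codim1_faces_def)
      then have "card (codim1_faces G) \<le> card {{} :: 'a set}"
        by (intro card_mono) auto
      then show ?thesis by simp
    next
      case 2
      show ?thesis unfolding 2 by (rule card_codim1_faces_cbox)
    next
      case 3
      then obtain i where i: "i \<in> nondegenerate_axes l u"
        "G \<subseteq> cbox l u \<inter> {x. i \<bullet> x = l \<bullet> i} \<or> G \<subseteq> cbox l u \<inter> {x. i \<bullet> x = u \<bullet> i}"
        using proper_face_of_cbox[OF G] by blast
      then have iB: "i \<in> Basis" and le: "l \<bullet> i \<le> u \<bullet> i"
        by (auto simp: nondegenerate_axes_def)
      have lt: "card (nondegenerate_axes l u - {i}) < card (nondegenerate_axes l u)"
        using i(1) by (intro card_Diff1_less) auto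
      have "box_like (cbox l u \<inter> {x. i \<bullet> x = l \<bullet> i})" "box_like (cbox l u \<inter> {x. i \<bullet> x = u \<bullet> i})"
        unfolding cbox_Int_lower_hyperplane[OF iB le] cbox_Int_upper_hyperplane[OF iB le]
        using lt by (auto intro!: less simp: nondegenerate_axes_collapse[OF iB])
      then obtain B where "box_like B" "G \<subseteq> B" "B \<subseteq> cbox l u"
        using i(2) by blast
      then show ?thesis
        using face_of_subset[OF G] by (auto simp: box_like_def)
    qed
  qed
qed

section \<open>Facet linking\<close>

text \<open>The barycenter is a convex combination of all vertices with positive weights.\<close>

lemma barycenter_in_rel_interior:
  assumes "polytope D" "D \<noteq> {}"
  shows "barycenter D \<in> rel_interior D"
proof -
  let ?V = "vertices D"
  have V: "?V = {v. v extreme_point_of D}"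
    using assms(1) by (rule vertices_polytope)
  have fin: "finite ?V"
    unfolding V by (rule finite_polyhedron_extreme_points[OF polytope_imp_polyhedron[OF assms(1)]])
  have D: "D = convex hull ?V"
    unfolding V using assms(1)
    by (intro Krein_Milman_Minkowski) (auto simp: polytope_imp_compact polytope_imp_convex)
  then have "?V \<noteq> {}" using assms(2) by auto
  then have c: "card ?V > 0" using fin by (simp add: card_gt_0_iff)
  have "barycenter D \<in> {y. \<exists>w. (\<forall>x\<in>?V. 0 < w x) \<and> sum w ?V = 1 \<and> (\<Sum>x\<in>?V. w x *\<^sub>R x) = y}"
    using c by (intro CollectI exI[of _ "\<lambda>_. 1 / real (card ?V)"])
      (simp add: barycenter_def scaleR_sum_right)
  then have "barycenter D \<in> rel_interior (convex hull ?V)"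
    using explicit_subset_rel_interior_convex_hull_minimal[OF fin] by blast
  then show ?thesis using D by simp
qed

lemma box_like_facet_linking:
  assumes "box_like D" "q \<in> rel_interior D" "E \<in> facet_linking q D"
  shows "box_like E" "E \<noteq> {}"
proof -
  obtain F where F: "F \<in> facets D" "E = convex hull (insert q F)"
    using assms(3) by (auto simp: facet_linking_def)
  then have face: "F face_of D" "F \<noteq> D"
    by (auto simp: facets_def exposed_face_of_def)
  have "convex D"
    using assms(1) by (simp add: box_like_def polytope_imp_convex)
  then have "q \<notin> affine hull F"
    using affine_hull_face_of_disjoint_rel_interior[OF _ face] assms(2) by blast
  then show "box_like E"
    unfolding F(2) using box_like_face[OF assms(1) face(1)] by (intro box_like_pyramid)
  show "E \<noteq> {}" by (simp add: F(2))
qed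

lemma box_like_pdm:
  assumes "pdm P J tol N \<gamma> \<D> err" "box_like P" "E \<in> \<D>"
  shows "box_like E \<and> E \<noteq> {}"
  using assms
proof (induction arbitrary: E rule: pdm.induct)
  case (init p)
  then have "p \<in> rel_interior P"
    using interior_subset_rel_interior by blast
  then show ?case
    using init box_like_facet_linking by blast
next
  case (step N \<gamma> \<D> err D)
  have "D \<in> \<D>"
    using step.hyps(3) by (simp add: is_arg_max_def)
  then have D: "box_like D" "D \<noteq> {}"
    using step.IH step.prems by auto
  then have "barycenter D \<in> rel_interior D"
    by (simp add: barycenter_in_rel_interior box_like_def)
  then show ?case
    using step.IH step.prems box_like_facet_linking[OF D(1)] by blast
qed

theorem corollary3p14:
  fixes P :: "(real ^ 'n) set"
    and J :: "real ^ 'n \<Rightarrow> (real ^ 'n) set \<Rightarrow> real"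
    and L tol :: real and N :: nat
    and \<D> :: "(real ^ 'n) set set" and D :: "(real ^ 'n) set"
  assumes "hyperrectangle P"
    and "objective P L J"
    and "N \<ge> 1"
    and "polytope_division P J tol N \<D>"
    and "D \<in> \<D>"
  shows "finite (facets D) \<and> card (facets D) \<le> 2 * CARD('n)"
proof -
  obtain l u where "P = cbox l u"
    using assms(1) by (auto simp: hyperrectangle_cbox)
  then have "box_like P"
    by (simp add: box_like_cbox)
  then have "box_like D"
    using assms(4,5) box_like_pdm unfolding polytope_division_def by blast
  then have D: "polytope D" "card (codim1_faces D) \<le> max 1 (2 * nat (aff_dim D))"
    using face_of_refl[OF polytope_imp_convex] by (auto simp: box_like_def)
  have fin: "finite (codim1_faces D)"
    using D(1) by (rule finite_codim1_faces)
  have "card (facets D) \<le> card (codim1_faces D)"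
    using fin facets_subset_codim1_faces by (rule card_mono)
  also have "\<dots> \<le> max 1 (2 * nat (aff_dim D))"
    by (rule D(2))
  also have "\<dots> \<le> 2 * CARD('n)"
  proof -
    have "aff_dim D \<le> int (CARD('n))"
      using aff_dim_le_DIM[of D] by simp
    moreover have "1 \<le> CARD('n)"
      by (simp add: Suc_leI)
    ultimately show ?thesis by linarith
  qed
  finally show ?thesis
    using finite_subset[OF facets_subset_codim1_faces fin] by simp
qed

end
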